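(* Let $M,N$ be $CL$-terms. If $[\![M]\!]_\rho=[\![N]\!]_\rho$ holds in every $LCL$-model $\langle\mathcal M,\rho\rangle$, then $M=N$ is provable in $\mathcal{EQ}^\eta$.
   Context: $CL$-terms are generated by $M,N ::= x \mid \mathsf{S} \mid \mathsf{K} \mid \mathsf{I} \mid MN$ over a countable set $V$ of term variables; $FV(M)$ is the set of variables of $M$. The equational theory $\mathcal{EQ}^\eta$ derives equations from the axioms $M=M$, $\mathsf S MNL=(ML)(NL)$, $\mathsf K MN=M$, $\mathsf I M=M$ and the rules: from $M=N$ infer $N=M$; from $M=N$, $N=L$ infer $M=L$; from $M=N$ infer $MP=NP$; from $M=N$ infer $PM=PN$; from $Mx=Nx$ with $x\notin FV(M)\cup FV(N)$ infer $M=N$. Simple types: $\sigma ::= a\mid\sigma\to\tau$; ${\sf Types}$ is the set of types. An applicative structure for $LCL$ is a tuple $\langle D,\{A^\sigma\}_{\sigma\in{\sf Types}},\cdot,\mathbf s,\mathbf k,\mathbf i\rangle$ where $D$ is nonempty; $A^\sigma\subseteq D$; $\cdot:D\times D\to D$ is extensional (if $d_1\cdot e=d_2\cdot e$ for all $e$ then $d_1=d_2$) and maps $A^{\sigma\to\tau}\times A^\sigma$ into $A^\tau$; $\mathbf s\in A^{(\sigma\to(\tau\to\rho))\to((\sigma\to\tau)\to(\sigma\to\rho))}$ for all $\sigma,\tau,\rho$ with $((\mathbf s\cdot d)\cdot e)\cdot f=(d\cdot f)\cdot(e\cdot f)$; $\mathbf k\in A^{\sigma\to(\tau\to\sigma)}$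 for all $\sigma,\tau$ with $(\mathbf k\cdot d)\cdot e=d$; $\mathbf i\in A^{\sigma\to\sigma}$ for all $\sigma$ with $\mathbf i\cdot d=d$ (all $d,e,f\in D$). An environment is a map $\rho:V\to D$; an $LCL$-model is a pair $\langle\mathcal M,\rho\rangle$. Interpretation: $[\![x]\!]_\rho=\rho(x)$, $[\![\mathsf S]\!]_\rho=\mathbf s$, $[\![\mathsf K]\!]_\rho=\mathbf k$, $[\![\mathsf I]\!]_\rho=\mathbf i$, $[\![MN]\!]_\rho=[\![M]\!]_\rho\cdot[\![N]\!]_\rho$. *)

theory Defs
  imports Main
begin

text \<open>The countable set of term variables is taken to be the natural numbers.\<close>

datatype cl =
    CVar nat
  | CS
  | CK
  | CI
  | CApp cl cl (infixl "\<bullet>" 75)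

primrec FV :: "cl \<Rightarrow> nat set" where
  "FV (CVar x) = {x}"
| "FV CS = {}"
| "FV CK = {}"
| "FV CI = {}"
| "FV (M \<bullet> N) = FV M \<union> FV N"

inductive EQ_eta :: "cl \<Rightarrow> cl \<Rightarrow> bool" where
  refl: "EQ_eta M M"
| S: "EQ_eta (CS \<bullet> M \<bullet> N \<bullet> L) ((M \<bullet> L) \<bullet> (N \<bullet> L))"
| K: "EQ_eta (CK \<bullet> M \<bullet> N) M"
| I: "EQ_eta (CI \<bullet> M) M"
| sym: "EQ_eta M N \<Longrightarrow> EQ_eta N M"
| trans: "EQ_eta M N \<Longrightarrow> EQ_eta N L \<Longrightarrow> EQ_eta M L"
| app_left: "EQ_eta M N \<Longrightarrow> EQ_eta (M \<bullet> P) (N \<bullet> P)"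
| app_right: "EQ_eta M N \<Longrightarrow> EQ_eta (P \<bullet> M) (P \<bullet> N)"
| ext: "EQ_eta (M \<bullet> CVar x) (N \<bullet> CVar x) \<Longrightarrow> x \<notin> FV M \<union> FV N \<Longrightarrow> EQ_eta M N"

text \<open>Simple types over an arbitrary collection of atoms.\<close>

datatype 'a ty =
    Atom 'a
  | Fun "'a ty" "'a ty" (infixr "\<rightarrow>\<^sub>t" 65)

record ('a, 'd) lcl_struct =
  Dom :: "'d set"
  Typ :: "'a ty \<Rightarrow> 'd set"
  app :: "'d \<Rightarrow> 'd \<Rightarrow> 'd" (infixl "\<odot>\<index>" 75)
  s_elem :: 'd
  k_elem :: 'd
  i_elem :: 'd

text \<open>The carrier is a subset of the type \<^typ>\<open>'d\<close>; application is a total HOL function of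
  which only the restriction to the carrier is constrained. That the three distinguished elements
  lie in the carrier follows from \<open>Typ_subset\<close> and their typings. Since HOL cannot quantify over
  types inside a formula, ``every model'' has to be read as every model with carrier contained in
  \<^typ>\<open>'d\<close>; any infinite \<^typ>\<open>'d\<close> has room for the (countable) term model.\<close>

locale lcl_applicative_structure =
  fixes \<M> :: "('a, 'd) lcl_struct" (structure)
  assumes Dom_nonempty: "Dom \<M> \<noteq> {}"
    and Typ_subset: "Typ \<M> \<sigma> \<subseteq> Dom \<M>"
    and app_closed: "d \<in> Dom \<M> \<Longrightarrow> e \<in> Dom \<M> \<Longrightarrow> d \<odot> e \<in> Dom \<M>"
    and app_ext: "d\<^sub>1 \<in> Dom \<M> \<Longrightarrow> d\<^sub>2 \<in> Dom \<M> \<Longrightarrow>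
      (\<And>e. e \<in> Dom \<M> \<Longrightarrow> d\<^sub>1 \<odot> e = d\<^sub>2 \<odot> e) \<Longrightarrow> d\<^sub>1 = d\<^sub>2"
    and app_typed: "d \<in> Typ \<M> (\<sigma> \<rightarrow>\<^sub>t \<tau>) \<Longrightarrow> e \<in> Typ \<M> \<sigma> \<Longrightarrow> d \<odot> e \<in> Typ \<M> \<tau>"
    and s_typed: "s_elem \<M> \<in>
      Typ \<M> ((\<sigma> \<rightarrow>\<^sub>t (\<tau> \<rightarrow>\<^sub>t \<rho>)) \<rightarrow>\<^sub>t ((\<sigma> \<rightarrow>\<^sub>t \<tau>) \<rightarrow>\<^sub>t (\<sigma> \<rightarrow>\<^sub>t \<rho>)))"
    and s_eq: "d \<in> Dom \<M> \<Longrightarrow> e \<in> Dom \<M> \<Longrightarrow> f \<in> Dom \<M> \<Longrightarrow>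
      ((s_elem \<M> \<odot> d) \<odot> e) \<odot> f = (d \<odot> f) \<odot> (e \<odot> f)"
    and k_typed: "k_elem \<M> \<in> Typ \<M> (\<sigma> \<rightarrow>\<^sub>t (\<tau> \<rightarrow>\<^sub>t \<sigma>))"
    and k_eq: "d \<in> Dom \<M> \<Longrightarrow> e \<in> Dom \<M> \<Longrightarrow> (k_elem \<M> \<odot> d) \<odot> e = d"
    and i_typed: "i_elem \<M> \<in> Typ \<M> (\<sigma> \<rightarrow>\<^sub>t \<sigma>)"
    and i_eq: "d \<in> Dom \<M> \<Longrightarrow> i_elem \<M> \<odot> d = d"

definition lcl_model :: "('a, 'd) lcl_struct \<Rightarrow> (nat \<Rightarrow> 'd) \<Rightarrow> bool" where
  "lcl_model \<M> \<rho> \<longleftrightarrow> lcl_applicative_structure \<M> \<and> (\<forall>x. \<rho> x \<in> Dom \<M>)"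

primrec interp :: "('a, 'd) lcl_struct \<Rightarrow> (nat \<Rightarrow> 'd) \<Rightarrow> cl \<Rightarrow> 'd" where
  "interp \<M> \<rho> (CVar x) = \<rho> x"
| "interp \<M> \<rho> CS = s_elem \<M>"
| "interp \<M> \<rho> CK = k_elem \<M>"
| "interp \<M> \<rho> CI = i_elem \<M>"
| "interp \<M> \<rho> (M \<bullet> N) = interp \<M> \<rho> M \<odot>\<^bsub>\<M>\<^esub> interp \<M> \<rho> N"

end

theory Submission
  imports Defs "HOL-Library.Countable"
begin

text \<open>The term model, whose elements are the classes of terms modulo provable equality, satisfies
  only the provable equations. It is extensional because two terms that agree on all arguments
  agree on a fresh variable. Since terms are countable, the classes embed into any infinite type;
  taking every type to denote the whole carrier trivializes the typing conditions.\<close>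

instance cl :: countable
  by countable_datatype

lemma finite_FV: "finite (FV M)"
  by (induction M) auto

lemma EQ_eta_app: "EQ_eta M M' \<Longrightarrow> EQ_eta N N' \<Longrightarrow> EQ_eta (M \<bullet> N) (M' \<bullet> N')"
  by (blast intro: EQ_eta.trans EQ_eta.app_left EQ_eta.app_right)

lemma EQ_eta_extensional:
  assumes "\<And>P. EQ_eta (M \<bullet> P) (N \<bullet> P)"
  shows "EQ_eta M N"
proof -
  obtain x where "x \<notin> FV M \<union> FV N"
    using ex_new_if_finite[of "FV M \<union> FV N"] finite_FV by auto
  with assms show ?thesis
    by (blast intro: EQ_eta.ext)
qed

text \<open>Realizes the quotient of terms by provable equality inside \<open>'d\<close>: each class
  is sent to a chosen representative, which is coded as a natural number and injected into
  \<open>'d\<close>.\<close>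

lemma ex_EQ_eta_classifier:
  assumes "infinite (UNIV :: 'd set)"
  shows "\<exists>g :: cl \<Rightarrow> 'd. \<forall>M N. g M = g N \<longleftrightarrow> EQ_eta M N"
proof -
  obtain h :: "nat \<Rightarrow> 'd" where h: "inj h"
    using infinite_countable_subset[OF assms] by blast
  have "EQ_eta M = EQ_eta N" if "EQ_eta M N" for M N
    using that by (blast intro: EQ_eta.sym EQ_eta.trans)
  \<comment> \<open>By reflexivity the class of \<open>M\<close> is inhabited, so the chosen term is
    provably equal to \<open>M\<close>; likewise for \<open>N\<close>.\<close>
  moreover have "EQ_eta M N" if "Eps (EQ_eta M) = Eps (EQ_eta N)" for M N
    using that by (metis EQ_eta.refl EQ_eta.sym EQ_eta.trans someI)
  ultimately have "h (to_nat (Eps (EQ_eta M))) = h (to_nat (Eps (EQ_eta N))) \<longleftrightarrow> EQ_eta M N" for M N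
    by (metis h inj_eq inj_to_nat)
  then show ?thesis
    by (intro exI[of _ "\<lambda>M. h (to_nat (Eps (EQ_eta M)))"]) blast
qed

definition term_model :: "(cl \<Rightarrow> 'd) \<Rightarrow> ('a, 'd) lcl_struct" where
  "term_model g = \<lparr>Dom = range g, Typ = (\<lambda>_. range g),
     app = (\<lambda>d e. g (inv g d \<bullet> inv g e)), s_elem = g CS, k_elem = g CK, i_elem = g CI\<rparr>"

context
  fixes g :: "cl \<Rightarrow> 'd"
  assumes g: "\<And>M N. g M = g N \<longleftrightarrow> EQ_eta M N"
begin

text \<open>Application goes through representatives picked by \<open>inv g\<close>; since provable
  equality is a congruence, the choice does not affect the class of the result.\<close>

lemma app_term_model: "app (term_model g) (g M) (g N) = g (M \<bullet> N)"
proof -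
  \<comment> \<open>\<open>g\<close> need not be injective, so \<open>inv g\<close> recovers
    \<open>L\<close> only up to provable equality.\<close>
  have "EQ_eta (inv g (g L)) L" for L
    by (metis g f_inv_into_f rangeI)
  then show ?thesis
    by (simp add: term_model_def g EQ_eta_app)
qed

lemma term_model_applicative_structure:
  "lcl_applicative_structure (term_model g :: ('a, 'd) lcl_struct)"
proof -
  let ?T = "term_model g :: ('a, 'd) lcl_struct"
  have sel: "Dom ?T = range g" "\<And>\<sigma>. Typ ?T \<sigma> = range g"
    "s_elem ?T = g CS" "k_elem ?T = g CK" "i_elem ?T = g CI"
    by (simp_all add: term_model_def)
  show ?thesis
  proof unfold_locales
    fix d\<^sub>1 d\<^sub>2
    assume "d\<^sub>1 \<in> Dom ?T" "d\<^sub>2 \<in> Dom ?T"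
      and eq: "\<And>e. e \<in> Dom ?T \<Longrightarrow> app ?T d\<^sub>1 e = app ?T d\<^sub>2 e"
    then obtain M N where MN: "d\<^sub>1 = g M" "d\<^sub>2 = g N"
      by (auto simp: sel)
    \<comment> \<open>Every term \<open>P\<close> names an element \<open>g P\<close> of the
      carrier, so \<open>eq\<close> may be instantiated there.\<close>
    have "EQ_eta (M \<bullet> P) (N \<bullet> P)" for P
      using eq[unfolded sel, OF rangeI] by (simp add: MN app_term_model g)
    then show "d\<^sub>1 = d\<^sub>2"
      by (simp add: MN g EQ_eta_extensional)
  qed (auto simp: sel app_term_model g intro: rangeI EQ_eta.S EQ_eta.K EQ_eta.I)
qed

text \<open>Under the environment sending each variable to its own class, equality of
  interpretations becomes provability.\<close>

lemma interp_term_model: "interp (term_model g) (\<lambda>x. g (CVar x)) M = g M"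
proof (induction M)
  case (CApp M N)
  then show ?case
    by (simp add: app_term_model)
qed (simp_all add: term_model_def)

end

theorem mainTheorem6:
  fixes M N :: cl
  assumes "infinite (UNIV :: 'd set)"
    and "\<forall>(\<M> :: ('a, 'd) lcl_struct) \<rho>. lcl_model \<M> \<rho> \<longrightarrow> interp \<M> \<rho> M = interp \<M> \<rho> N"
  shows "EQ_eta M N"
proof -
  obtain g :: "cl \<Rightarrow> 'd" where g: "\<And>M N. g M = g N \<longleftrightarrow> EQ_eta M N"
    using ex_EQ_eta_classifier[OF assms(1)] by blast
  have "lcl_model (term_model g :: ('a, 'd) lcl_struct) (\<lambda>x. g (CVar x))"
    using term_model_applicative_structure[OF g] by (simp add: lcl_model_def term_model_def)
  with assms(2) have "interp (term_model g :: ('a, 'd) lcl_struct) (\<lambda>x. g (CVar x)) M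
      = interp (term_model g :: ('a, 'd) lcl_struct) (\<lambda>x. g (CVar x)) N"
    by blast
  then show ?thesis
    by (simp add: interp_term_model[OF g] g)
qed

end
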